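(* Let $\mathbf{x}\in\mathbb{R}^{r_1}$, $\mathbf{y}\in\mathbb{R}^{r_2}$, $\mathbf{z}\in\mathbb{R}^{r_3}$, and let $\phi(\mathbf{x},\mathbf{y})=\bigwedge_{i=1}^m f_i(\mathbf{x},\mathbf{y})\ge0$ and $\psi(\mathbf{x},\mathbf{z})=\bigwedge_{j=1}^n g_j(\mathbf{x},\mathbf{z})\ge0$ with $f_i\in\mathbb{R}[\mathbf{x},\mathbf{y}]$, $g_j\in\mathbb{R}[\mathbf{x},\mathbf{z}]$. Let $\tilde f_i$, $\tilde g_j$ be their homogenizations and set $\tilde f_{m+1}=\tilde g_{n+1}=x_0$, $\tilde f_{m+2}=x_0^2+\|\mathbf{x}\|^2+\|\mathbf{y}\|^2-1$, $\tilde g_{n+2}=x_0^2+\|\mathbf{x}\|^2+\|\mathbf{z}\|^2-1$. Suppose $h\in\mathbb{R}[\mathbf{x}]$ is a polynomial whose homogenization $\tilde h(x_0,\mathbf{x})$ satisfies $\tilde h(x_0,\mathbf{x})=\sigma_0+\sum_{i=1}^{m+2}\sigma_i\tilde f_i(x_0,\mathbf{x},\mathbf{y})$ and $-\tilde h(x_0,\mathbf{x})=\tau_0+\sum_{j=1}^{n+2}\tau_j\tilde g_j(x_0,\mathbf{x},\mathbf{z})$ for some $\sigma_0,\dots,\sigma_{m+1}\in\Sigma[x_0,\mathbf{x},\mathbf{y}]$, $\sigma_{m+2}\in\mathbb{R}[x_0,\mathbf{x},\mathbf{y}]$, $\tau_0,\dots,\tau_{n+1}\in\Sigma[x_0,\mathbf{x},\mathbf{z}]$,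 $\tau_{n+2}\in\mathbb{R}[x_0,\mathbf{x},\mathbf{z}]$. Assume that there is no $(\mathbf{x},\mathbf{y})$ satisfying $\phi(\mathbf{x},\mathbf{y})$ with $h(\mathbf{x})=0$, and no $(\mathbf{x},\mathbf{z})$ satisfying $\psi(\mathbf{x},\mathbf{z})$ with $h(\mathbf{x})=0$. Then $h$ is an interpolant function of $\phi$ and $\psi$, i.e. $\phi(\mathbf{x},\mathbf{y})\models h(\mathbf{x})>0$ and $\psi(\mathbf{x},\mathbf{z})\models h(\mathbf{x})<0$.
   Context: For a polynomial $f$ in variables $\mathbf{u}=(u_1,\dots,u_s)$ of total degree $d_f$, its homogenization is $\tilde f(x_0,\mathbf{u})=x_0^{d_f}f(u_1/x_0,\dots,u_s/x_0)$ with a fresh variable $x_0$. $\Sigma[\mathbf{u}]$ denotes the set of finite sums of squares of polynomials in $\mathbb{R}[\mathbf{u}]$. *)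

theory Defs
  imports Complex_Main "HOL-Library.Poly_Mapping" "HOL-Library.FuncSet"
begin

text \<open>
  All polynomials live in one ring of real polynomials over the variables below, so that
  $\mathbb{R}[\mathbf{x}]$, $\mathbb{R}[x_0,\mathbf{x},\mathbf{y}]$, etc. are subrings of it and the
  certificate identities can be written without embeddings. \<open>X0\<close> is the homogenizing variable
  $x_0$; the coordinates of $\mathbf{x}$ are \<open>X 1, \<dots>, X r1\<close>, and similarly for \<open>Y\<close> and \<open>Z\<close>.
\<close>

datatype pvar = X0 | X nat | Y nat | Z nat

type_synonym mpoly = "(pvar \<Rightarrow>\<^sub>0 nat) \<Rightarrow>\<^sub>0 real"

definition Var :: "pvar \<Rightarrow> mpoly" where
  "Var v = Poly_Mapping.single (Poly_Mapping.single v 1) 1"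

definition polys :: "pvar set \<Rightarrow> mpoly set" where
  "polys V = {p. \<forall>t \<in> Poly_Mapping.keys p. Poly_Mapping.keys t \<subseteq> V}"

definition peval :: "mpoly \<Rightarrow> (pvar \<Rightarrow> real) \<Rightarrow> real" where
  "peval p a = (\<Sum>t \<in> Poly_Mapping.keys p.
      Poly_Mapping.lookup p t * (\<Prod>v \<in> Poly_Mapping.keys t. a v ^ Poly_Mapping.lookup t v))"

definition mon_degree :: "(pvar \<Rightarrow>\<^sub>0 nat) \<Rightarrow> nat" where
  "mon_degree t = (\<Sum>v \<in> Poly_Mapping.keys t. Poly_Mapping.lookup t v)"

definition total_degree :: "mpoly \<Rightarrow> nat" where
  "total_degree p = Max (insert 0 (mon_degree ` Poly_Mapping.keys p))"

text \<open>
  $x_0^{d}\,p(\mathbf{u}/x_0)$ with $d$ the total degree of $p$, expanded monomial by monomial;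
  meant for \<open>p\<close> not involving \<open>X0\<close>, see \<open>peval_homogenize\<close> below.
\<close>

definition homogenize :: "mpoly \<Rightarrow> mpoly" where
  "homogenize p = (\<Sum>t \<in> Poly_Mapping.keys p.
      Poly_Mapping.single (t + Poly_Mapping.single X0 (total_degree p - mon_degree t))
        (Poly_Mapping.lookup p t))"

definition sos :: "pvar set \<Rightarrow> mpoly set" where
  "sos V = {p. \<exists>qs. set qs \<subseteq> polys V \<and> p = (\<Sum>q\<leftarrow>qs. q\<^sup>2)}"

definition xvars :: "nat \<Rightarrow> pvar set" where "xvars r = X ` {1..r}"
definition yvars :: "nat \<Rightarrow> pvar set" where "yvars r = Y ` {1..r}"
definition zvars :: "nat \<Rightarrow> pvar set" where "zvars r = Z ` {1..r}"

definition Rn :: "nat \<Rightarrow> (nat \<Rightarrow> real) set" where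
  "Rn r = {1..r} \<rightarrow>\<^sub>E UNIV"

text \<open>
  The valuations given by points $\mathbf{x}$, $(\mathbf{x},\mathbf{y})$ and
  $(\mathbf{x},\mathbf{z})$; the value \<open>0\<close> for the other variables is a dummy, as these valuations
  are only applied to polynomials in which those variables do not occur.
\<close>

definition at_x :: "(nat \<Rightarrow> real) \<Rightarrow> pvar \<Rightarrow> real" where
  "at_x x v = (case v of X i \<Rightarrow> x i | _ \<Rightarrow> 0)"

definition at_xy :: "(nat \<Rightarrow> real) \<Rightarrow> (nat \<Rightarrow> real) \<Rightarrow> pvar \<Rightarrow> real" where
  "at_xy x y v = (case v of X i \<Rightarrow> x i | Y i \<Rightarrow> y i | _ \<Rightarrow> 0)"

definition at_xz :: "(nat \<Rightarrow> real) \<Rightarrow> (nat \<Rightarrow> real) \<Rightarrow> pvar \<Rightarrow> real" where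
  "at_xz x z v = (case v of X i \<Rightarrow> x i | Z i \<Rightarrow> z i | _ \<Rightarrow> 0)"

definition interpolant_function ::
  "nat \<Rightarrow> nat \<Rightarrow> nat \<Rightarrow> ((nat \<Rightarrow> real) \<Rightarrow> (nat \<Rightarrow> real) \<Rightarrow> bool) \<Rightarrow>
    ((nat \<Rightarrow> real) \<Rightarrow> (nat \<Rightarrow> real) \<Rightarrow> bool) \<Rightarrow> mpoly \<Rightarrow> bool" where
  "interpolant_function r1 r2 r3 \<phi> \<psi> h \<longleftrightarrow>
    (\<forall>x \<in> Rn r1. \<forall>y \<in> Rn r2. \<phi> x y \<longrightarrow> peval h (at_x x) > 0) \<and>
    (\<forall>x \<in> Rn r1. \<forall>z \<in> Rn r3. \<psi> x z \<longrightarrow> peval h (at_x x) < 0)"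

lemma peval_superset:
  assumes "finite T" "Poly_Mapping.keys p \<subseteq> T"
  shows "peval p a = (\<Sum>t \<in> T.
      Poly_Mapping.lookup p t * (\<Prod>v \<in> Poly_Mapping.keys t. a v ^ Poly_Mapping.lookup t v))"
  unfolding peval_def
  by (rule sum.mono_neutral_left) (use assms in \<open>auto simp: in_keys_iff\<close>)

lemma peval_add: "peval (p + q) a = peval p a + peval q a"
proof -
  let ?T = "Poly_Mapping.keys p \<union> Poly_Mapping.keys q"
  have "Poly_Mapping.keys (p + q) \<subseteq> ?T"
    by (rule keys_add)
  then show ?thesis
    by (simp add: peval_superset[of ?T] lookup_add ring_distribs sum.distrib)
qed

lemma peval_zero [simp]: "peval 0 a = 0"
  by (simp add: peval_def)

lemma peval_sum: "peval (\<Sum>i\<in>I. p i) a = (\<Sum>i\<in>I. peval (p i) a)"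
  by (induction I rule: infinite_finite_induct) (auto simp: peval_add)

lemma peval_single:
  "peval (Poly_Mapping.single t c) a =
    c * (\<Prod>v \<in> Poly_Mapping.keys t. a v ^ Poly_Mapping.lookup t v)"
  by (simp add: peval_superset[of "{t}"])

lemma mon_degree_le_total_degree:
  "t \<in> Poly_Mapping.keys p \<Longrightarrow> mon_degree t \<le> total_degree p"
  unfolding total_degree_def by (rule Max_ge) auto

lemma peval_homogenize:
  assumes "p \<in> polys V" "X0 \<notin> V" "a X0 \<noteq> 0"
  shows "peval (homogenize p) a = a X0 ^ total_degree p * peval p (\<lambda>v. a v / a X0)"
proof -
  have mon: "(\<Prod>v \<in> Poly_Mapping.keys (t + Poly_Mapping.single X0 k).
               a v ^ Poly_Mapping.lookup (t + Poly_Mapping.single X0 k) v) =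
             a X0 ^ total_degree p *
               (\<Prod>v \<in> Poly_Mapping.keys t. (a v / a X0) ^ Poly_Mapping.lookup t v)"
    if t: "t \<in> Poly_Mapping.keys p" and k: "k = total_degree p - mon_degree t" for t k
  proof -
    let ?s = "t + Poly_Mapping.single X0 k"
    have X0: "X0 \<notin> Poly_Mapping.keys t"
      using assms t by (auto simp: polys_def)
    have "(\<Prod>v \<in> Poly_Mapping.keys ?s. a v ^ Poly_Mapping.lookup ?s v) =
          (\<Prod>v \<in> insert X0 (Poly_Mapping.keys t). a v ^ Poly_Mapping.lookup ?s v)"
    proof (rule prod.mono_neutral_left)
      show "Poly_Mapping.keys ?s \<subseteq> insert X0 (Poly_Mapping.keys t)"
        using keys_add[of t "Poly_Mapping.single X0 k"] by (auto split: if_splits)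
    qed (auto simp: in_keys_iff)
    also have "\<dots> = a X0 ^ k * (\<Prod>v \<in> Poly_Mapping.keys t. a v ^ Poly_Mapping.lookup ?s v)"
      using X0 by (simp add: lookup_add in_keys_iff)
    also have "(\<Prod>v \<in> Poly_Mapping.keys t. a v ^ Poly_Mapping.lookup ?s v) =
               (\<Prod>v \<in> Poly_Mapping.keys t. a v ^ Poly_Mapping.lookup t v)"
      using X0 by (intro prod.cong refl) (auto simp: lookup_add lookup_single when_def)
    also have "\<dots> = a X0 ^ mon_degree t *
               (\<Prod>v \<in> Poly_Mapping.keys t. (a v / a X0) ^ Poly_Mapping.lookup t v)"
      using assms(3) by (simp add: mon_degree_def power_sum power_divide flip: prod.distrib)
    finally show ?thesis
      using mon_degree_le_total_degree[OF t] k by (simp add: mult.assoc[symmetric] flip: power_add)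
  qed
  show ?thesis
    unfolding homogenize_def peval_sum peval_single
    by (subst peval_def, subst sum_distrib_left) (intro sum.cong refl, simp add: mon)
qed

end

theory Submission
  imports Defs
begin

text \<open>
  For a model \<open>b\<close> of \<open>\<phi>\<close>, the point of homogeneous coordinates \<open>(1, b)\<close> can be rescaled by a
  positive factor \<open>c\<close> to lie on the unit sphere. There the last certificate term vanishes, whereas
  all other terms are nonnegative, because evaluating a homogenization at \<open>c (1, b)\<close> only multiplies
  the value at \<open>b\<close> by a power of \<open>c\<close>. Hence \<open>h\<close> is nonnegative at \<open>b\<close>, and by assumption it is
  nonzero there. The argument for \<open>\<psi>\<close> and \<open>- h\<close> is the same.
\<close>

text \<open>A key outside the support of a monomial has exponent 0 and contributes a factor 1, so
  all three products may run over the common set \<open>?K\<close>, where exponents add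
  pointwise.\<close>

lemma prod_power_keys_add:
  fixes a :: "'a \<Rightarrow> real"
  shows "(\<Prod>v \<in> Poly_Mapping.keys (s + t). a v ^ Poly_Mapping.lookup (s + t) v) =
    (\<Prod>v \<in> Poly_Mapping.keys s. a v ^ Poly_Mapping.lookup s v) *
    (\<Prod>v \<in> Poly_Mapping.keys t. a v ^ Poly_Mapping.lookup t v)"
proof -
  let ?K = "Poly_Mapping.keys s \<union> Poly_Mapping.keys t"
  have superset: "(\<Prod>v \<in> Poly_Mapping.keys u. a v ^ Poly_Mapping.lookup u v) =
      (\<Prod>v \<in> ?K. a v ^ Poly_Mapping.lookup u v)" if "Poly_Mapping.keys u \<subseteq> ?K" for u
    by (rule prod.mono_neutral_left) (use that in \<open>auto simp: in_keys_iff\<close>)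
  show ?thesis
    using keys_add[of s t] superset[of s] superset[of t] superset[of "s + t"]
    by (simp only: lookup_add power_add prod.distrib) simp
qed

lemma sum_single_lookup:
  "(\<Sum>t \<in> Poly_Mapping.keys p. Poly_Mapping.single t (Poly_Mapping.lookup p t)) = p"
  by (rule poly_mapping_eqI) (auto simp: lookup_sum lookup_single when_def in_keys_iff)

lemma peval_mult: "peval (p * q) a = peval p a * peval q a"
proof -
  \<comment> \<open>Expanding both factors into monomials leaves only the multiplicativity of
    monomial evaluation.\<close>
  have "p * q = (\<Sum>s \<in> Poly_Mapping.keys p. \<Sum>t \<in> Poly_Mapping.keys q.
      Poly_Mapping.single (s + t) (Poly_Mapping.lookup p s * Poly_Mapping.lookup q t))"
    by (subst (1 2) sum_single_lookup[symmetric], subst sum_product) (simp add: mult_single)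
  then show ?thesis
    by (simp add: peval_sum peval_single prod_power_keys_add)
       (simp add: peval_def sum_product algebra_simps)
qed

lemma peval_one: "peval 1 a = 1"
  by (simp add: peval_single flip: single_one)

lemma peval_uminus: "peval (- p) a = - peval p a"
  using peval_add[of p "- p" a] by simp

lemma peval_diff: "peval (p - q) a = peval p a - peval q a"
  using peval_add[of p "- q" a] by (simp add: peval_uminus)

lemma peval_power2: "peval (p\<^sup>2) a = (peval p a)\<^sup>2"
  by (simp add: power2_eq_square peval_mult)

lemma peval_Var: "peval (Var v) a = a v"
  by (simp add: Var_def peval_single)

lemma peval_sos_nonneg:
  assumes "p \<in> sos V"
  shows "peval p a \<ge> 0"
proof -
  have "peval (\<Sum>q\<leftarrow>qs. q\<^sup>2) a \<ge> 0" for qs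
    by (induction qs) (auto simp: peval_add peval_power2)
  then show ?thesis
    using assms by (auto simp: sos_def)
qed

text \<open>This makes the dummy values in \<open>at_x\<close>, \<open>at_xy\<close> and
  \<open>at_xz\<close> harmless, as well as overriding a valuation at \<open>X0\<close>.\<close>

lemma peval_cong:
  assumes "p \<in> polys V" "\<And>v. v \<in> V \<Longrightarrow> a v = b v"
  shows "peval p a = peval p b"
  unfolding peval_def using assms
  by (intro sum.cong arg_cong2[where f = "(*)"] prod.cong refl) (auto simp: polys_def subset_iff)

text \<open>Dividing by the \<open>X0\<close>-coordinate \<open>c\<close> undoes the scaling and
  gives back \<open>b\<close> on \<open>V\<close>, which is all that \<open>p\<close> sees.\<close>

lemma peval_homogenize_scaled:
  assumes "p \<in> polys V" "X0 \<notin> V" "c \<noteq> 0"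
  shows "peval (homogenize p) (\<lambda>v. c * (b(X0 := 1)) v) = c ^ total_degree p * peval p b"
proof -
  have "peval p (\<lambda>v. c * (b(X0 := 1)) v / (c * (b(X0 := 1)) X0)) = peval p b"
    using assms by (intro peval_cong[OF assms(1)]) auto
  then show ?thesis
    using assms by (simp add: peval_homogenize)
qed

text \<open>With \<open>q\<close> arbitrary, this serves both \<open>homogenize h\<close> and its
  negative. Nothing is assumed about the multiplier \<open>\<sigma> (m + 2)\<close>, since its
  factor vanishes at the chosen point.\<close>

lemma certificate_nonneg:
  fixes m :: nat
  assumes V: "finite V" "X0 \<notin> V"
    and f: "\<forall>i \<in> {1..m}. f i \<in> polys V"
    and f': "\<forall>i \<in> {1..m}. f' i = homogenize (f i)" "f' (m + 1) = Var X0"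
      "f' (m + 2) = (Var X0)\<^sup>2 + (\<Sum>v\<in>V. (Var v)\<^sup>2) - 1"
    and \<sigma>: "\<forall>i \<in> {0..m + 1}. \<sigma> i \<in> sos W"
    and q: "q = \<sigma> 0 + (\<Sum>i = 1..m + 2. \<sigma> i * f' i)"
    and b: "\<forall>i \<in> {1..m}. peval (f i) b \<ge> 0"
  obtains c where "c > 0" "peval q (\<lambda>v. c * (b(X0 := 1)) v) \<ge> 0"
proof
  \<comment> \<open>The squared norm of \<open>(1, b)\<close> over \<open>X0\<close> and
    \<open>V\<close>; the summand 1 keeps it positive even when \<open>b\<close> vanishes on
    \<open>V\<close>.\<close>
  define S where "S = 1 + (\<Sum>v\<in>V. (b v)\<^sup>2)"
  define c where "c = 1 / sqrt S"
  let ?a = "\<lambda>v. c * (b(X0 := 1)) v"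
  have S: "S > 0"
    unfolding S_def by (intro add_pos_nonneg sum_nonneg) auto
  then show c: "1 / sqrt S > 0"
    by simp
  have sphere: "peval (f' (m + 2)) ?a = 0"
  proof -
    have "(\<Sum>v\<in>V. (?a v)\<^sup>2) = c\<^sup>2 * (\<Sum>v\<in>V. (b v)\<^sup>2)"
      using V by (auto simp: sum_distrib_left power_mult_distrib intro!: sum.cong)
    then have "peval (f' (m + 2)) ?a = c\<^sup>2 * S - 1"
      unfolding f' peval_diff peval_add peval_sum peval_power2 peval_Var peval_one S_def
      by (simp add: algebra_simps)
    then show ?thesis
      using S by (simp add: c_def power_divide)
  qed
  have "peval (\<sigma> i * f' i) ?a \<ge> 0" if i: "i \<in> {1..m + 2}" for i
  proof -
    consider "i \<in> {1..m}" | "i = m + 1" | "i = m + 2"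
      using i by force
    then show ?thesis
    proof cases
      case 1
      \<comment> \<open>The value is \<open>peval (f i) b\<close> times a power of
        \<open>c\<close>.\<close>
      then have "peval (f' i) ?a \<ge> 0"
        using f f'(1) b c peval_homogenize_scaled[of "f i" V c b] V
        by (simp add: c_def)
      then show ?thesis
        using 1 \<sigma> peval_sos_nonneg[of "\<sigma> i" W ?a] by (simp add: peval_mult)
    next
      case 2
      \<comment> \<open>Here the factor \<open>Var X0\<close> takes the value \<open>c\<close>,
        which is positive.\<close>
      then show ?thesis
        using \<sigma> c peval_sos_nonneg[of "\<sigma> i" W ?a] f'(2) by (simp add: peval_mult peval_Var c_def)
    next
      case 3
      then show ?thesis
        using sphere by (simp add: peval_mult)
    qed
  qed
  then have "peval q ?a \<ge> 0"
    unfolding q peval_add peval_sum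
    using \<sigma> by (intro add_nonneg_nonneg sum_nonneg peval_sos_nonneg[of "\<sigma> 0" W]) auto
  then show "peval q (\<lambda>v. 1 / sqrt S * (b(X0 := 1)) v) \<ge> 0"
    by (simp add: c_def)
qed

theorem theorem5:
  fixes r1 r2 r3 m n :: nat
    and f g f' g' \<sigma> \<tau> :: "nat \<Rightarrow> mpoly"
    and h :: mpoly
    and \<phi> \<psi> :: "(nat \<Rightarrow> real) \<Rightarrow> (nat \<Rightarrow> real) \<Rightarrow> bool"
  assumes f_poly: "\<forall>i \<in> {1..m}. f i \<in> polys (xvars r1 \<union> yvars r2)"
    and g_poly: "\<forall>j \<in> {1..n}. g j \<in> polys (xvars r1 \<union> zvars r3)"
    and phi: "\<forall>x \<in> Rn r1. \<forall>y \<in> Rn r2. \<phi> x y \<longleftrightarrow> (\<forall>i \<in> {1..m}. peval (f i) (at_xy x y) \<ge> 0)"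
    and psi: "\<forall>x \<in> Rn r1. \<forall>z \<in> Rn r3. \<psi> x z \<longleftrightarrow> (\<forall>j \<in> {1..n}. peval (g j) (at_xz x z) \<ge> 0)"
    and f'_hom: "\<forall>i \<in> {1..m}. f' i = homogenize (f i)"
    and g'_hom: "\<forall>j \<in> {1..n}. g' j = homogenize (g j)"
    and f'_x0: "f' (m + 1) = Var X0"
    and g'_x0: "g' (n + 1) = Var X0"
    and f'_sphere: "f' (m + 2) =
      (Var X0)\<^sup>2 + (\<Sum>i = 1..r1. (Var (X i))\<^sup>2) + (\<Sum>i = 1..r2. (Var (Y i))\<^sup>2) - 1"
    and g'_sphere: "g' (n + 2) =
      (Var X0)\<^sup>2 + (\<Sum>i = 1..r1. (Var (X i))\<^sup>2) + (\<Sum>i = 1..r3. (Var (Z i))\<^sup>2) - 1"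
    and h_poly: "h \<in> polys (xvars r1)"
    and sigma_sos: "\<forall>i \<in> {0..m + 1}. \<sigma> i \<in> sos ({X0} \<union> xvars r1 \<union> yvars r2)"
    and sigma_poly: "\<sigma> (m + 2) \<in> polys ({X0} \<union> xvars r1 \<union> yvars r2)"
    and tau_sos: "\<forall>j \<in> {0..n + 1}. \<tau> j \<in> sos ({X0} \<union> xvars r1 \<union> zvars r3)"
    and tau_poly: "\<tau> (n + 2) \<in> polys ({X0} \<union> xvars r1 \<union> zvars r3)"
    and cert_f: "homogenize h = \<sigma> 0 + (\<Sum>i = 1..m + 2. \<sigma> i * f' i)"
    and cert_g: "- homogenize h = \<tau> 0 + (\<Sum>j = 1..n + 2. \<tau> j * g' j)"
    and no_zero_phi: "\<not> (\<exists>x \<in> Rn r1. \<exists>y \<in> Rn r2. \<phi> x y \<and> peval h (at_x x) = 0)"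
    and no_zero_psi: "\<not> (\<exists>x \<in> Rn r1. \<exists>z \<in> Rn r3. \<psi> x z \<and> peval h (at_x x) = 0)"
  shows "interpolant_function r1 r2 r3 \<phi> \<psi> h"
proof -
  \<comment> \<open>The certificates are evaluated at points over \<open>(x, y)\<close> or
    \<open>(x, z)\<close>, whereas the conclusion concerns \<open>x\<close> alone.\<close>
  have h_xy: "peval h (at_xy x y) = peval h (at_x x)" for x y
    by (rule peval_cong[OF h_poly]) (auto simp: at_xy_def at_x_def xvars_def)
  have h_xz: "peval h (at_xz x z) = peval h (at_x x)" for x z
    by (rule peval_cong[OF h_poly]) (auto simp: at_xz_def at_x_def xvars_def)
  have sum_xy: "(\<Sum>v \<in> xvars r1 \<union> yvars r2. (Var v)\<^sup>2) =
      (\<Sum>i = 1..r1. (Var (X i))\<^sup>2) + (\<Sum>i = 1..r2. (Var (Y i))\<^sup>2)"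
    unfolding xvars_def yvars_def
    by (subst sum.union_disjoint) (auto simp: sum.reindex inj_on_def)
  have sum_xz: "(\<Sum>v \<in> xvars r1 \<union> zvars r3. (Var v)\<^sup>2) =
      (\<Sum>i = 1..r1. (Var (X i))\<^sup>2) + (\<Sum>i = 1..r3. (Var (Z i))\<^sup>2)"
    unfolding xvars_def zvars_def
    by (subst sum.union_disjoint) (auto simp: sum.reindex inj_on_def)
  have X0: "X0 \<notin> xvars r1" "X0 \<notin> xvars r1 \<union> yvars r2" "X0 \<notin> xvars r1 \<union> zvars r3"
    by (auto simp: xvars_def yvars_def zvars_def)
  have fin: "finite (xvars r1 \<union> yvars r2)" "finite (xvars r1 \<union> zvars r3)"
    by (auto simp: xvars_def yvars_def zvars_def)
  have sphere_f: "f' (m + 2) = (Var X0)\<^sup>2 + (\<Sum>v \<in> xvars r1 \<union> yvars r2. (Var v)\<^sup>2) - 1"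
    using f'_sphere by (simp add: sum_xy add.assoc)
  have sphere_g: "g' (n + 2) = (Var X0)\<^sup>2 + (\<Sum>v \<in> xvars r1 \<union> zvars r3. (Var v)\<^sup>2) - 1"
    using g'_sphere by (simp add: sum_xz add.assoc)
  have pos: "peval h (at_x x) > 0" if xy: "x \<in> Rn r1" "y \<in> Rn r2" "\<phi> x y" for x y
  proof -
    have "\<forall>i \<in> {1..m}. peval (f i) (at_xy x y) \<ge> 0"
      using phi xy by blast
    then obtain c where "c > 0" "peval (homogenize h) (\<lambda>v. c * ((at_xy x y)(X0 := 1)) v) \<ge> 0"
      using certificate_nonneg[OF fin(1) X0(2) f_poly f'_hom f'_x0 sphere_f sigma_sos cert_f]
      by blast
    \<comment> \<open>The value of the homogenization is
      \<open>c ^ total_degree h * peval h (at_x x)\<close>, and the power of \<open>c\<close> is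
      positive.\<close>
    then have "peval h (at_x x) \<ge> 0"
      using peval_homogenize_scaled[OF h_poly X0(1), of c "at_xy x y"]
      by (metis h_xy less_irrefl mult_pos_neg not_le zero_less_power)
    moreover have "peval h (at_x x) \<noteq> 0"
      using no_zero_phi xy by blast
    ultimately show ?thesis
      by simp
  qed
  have neg: "peval h (at_x x) < 0" if xz: "x \<in> Rn r1" "z \<in> Rn r3" "\<psi> x z" for x z
  proof -
    have "\<forall>j \<in> {1..n}. peval (g j) (at_xz x z) \<ge> 0"
      using psi xz by blast
    then obtain c where "c > 0" "peval (- homogenize h) (\<lambda>v. c * ((at_xz x z)(X0 := 1)) v) \<ge> 0"
      using certificate_nonneg[OF fin(2) X0(3) g_poly g'_hom g'_x0 sphere_g tau_sos cert_g]
      by blast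
    \<comment> \<open>The second certificate bounds the negated homogenization from below, so
      cancelling the positive power of \<open>c\<close> bounds \<open>h\<close> from above.\<close>
    then have "peval h (at_x x) \<le> 0"
      using peval_homogenize_scaled[OF h_poly X0(1), of c "at_xz x z"]
      by (metis h_xz less_irrefl mult_pos_pos neg_0_le_iff_le not_le peval_uminus zero_less_power)
    moreover have "peval h (at_x x) \<noteq> 0"
      using no_zero_psi xz by blast
    ultimately show ?thesis
      by simp
  qed
  show ?thesis
    unfolding interpolant_function_def using pos neg by blast
qed

end
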